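(* Let $d\ge1$, let $\mathbb{R}^d$ be equipped with the $\ell_\infty$-norm, let $\mathcal{X}=[-1,1]^d$ be equipped with the Lebesgue measure $\mu$ normalized so that $\mu(\mathcal{X})=1$, and let $\alpha\in(0,1]$, $p\in[1,\infty)$, $M\ge1$, $\varepsilon\ge0$. For $x^{(1)},\ldots,x^{(M)}\in\mathcal{X}$, let $$u_{\mathbf{0},\boldsymbol{\varepsilon}}(x)=\min_{1\le m\le M}\big(\varepsilon+\|x-x^{(m)}\|_{\ell_\infty^d}^\alpha\big),\qquad x\in\mathcal{X}.$$ Then $$\inf_{x^{(1)},\ldots,x^{(M)}\in\mathcal{X}}\|u_{\mathbf{0},\boldsymbol{\varepsilon}}\|_{L_p(\mathcal{X})}^p\ \ge\ \Big(\varepsilon+\frac{1}{M^{\alpha/d}}\Big)^p-M\int_{\varepsilon^p}^{(\varepsilon+1/M^{\alpha/d})^p}(t^{1/p}-\varepsilon)^{d/\alpha}\,dt,$$ with equality being achieved when $M^{1/d}$ is an integer. Furthermore, if $\varepsilon=0$, then $$\inf_{x^{(1)},\ldots,x^{(M)}\in\mathcal{X}}\|u_{\mathbf{0},\boldsymbol{\varepsilon}}\|_{L_p(\mathcal{X})}\ \ge\ \Big(\frac{d}{d+\alpha p}\Big)^{1/p}\frac{1}{M^{\alpha/d}},$$ with equality when $M^{1/d}$ is an integer.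
   Context: $L_p(\mathcal{X})$ is taken with respect to the normalized (probability) Lebesgue measure $\mu$ on $\mathcal{X}=[-1,1]^d$. *)

theory Defs
  imports "HOL-Analysis.Analysis"
begin

definition cube :: "(real ^ 'n::finite) set" where
  "cube = cbox (- 1) 1"

lemma mem_cube_iff: "x \<in> cube \<longleftrightarrow> (\<forall>i. x $ i \<in> {-1..1})"
  by (auto simp: cube_def mem_box_cart)

(* The underlying space of this measure is all of R^n; the complement of the cube is a null set,
   so integrating against it is integrating over the cube. *)
definition cube_measure :: "(real ^ 'n::finite) measure" where
  "cube_measure = uniform_measure lborel cube"

lemma emeasure_lborel_cube: "emeasure lborel (cube :: (real ^ 'n::finite) set) = 2 ^ CARD('n)"
proof -
  have "(\<Prod>b\<in>(Basis :: (real ^ 'n) set). ((1 :: real ^ 'n) - - 1) \<bullet> b) = (\<Prod>b\<in>(Basis :: (real ^ 'n) set). 2)"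
    by (intro prod.cong) (auto simp: Basis_vec_def inner_axis)
  also have "\<dots> = 2 ^ CARD('n)"
    by simp
  moreover have "(- 1 :: real ^ 'n) \<bullet> b \<le> 1 \<bullet> b" if "b \<in> Basis" for b
    using that by (auto simp: Basis_vec_def inner_axis)
  ultimately show ?thesis
    by (simp add: cube_def emeasure_lborel_cbox_eq flip: ennreal_power)
qed

lemma emeasure_cube_measure_cube: "emeasure cube_measure (cube :: (real ^ 'n::finite) set) = 1"
  unfolding cube_measure_def
  by (rule emeasure_uniform_measure_1)
    (auto simp: emeasure_lborel_cube power_eq_top_ennreal)

(* Meaningful only when \<bar>f\<bar> powr p is integrable; for cover_fun below see integrable_cover_fun. *)
definition Lp_norm :: "'a measure \<Rightarrow> real \<Rightarrow> ('a \<Rightarrow> real) \<Rightarrow> real" where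
  "Lp_norm N p f = (\<integral>x. \<bar>f x\<bar> powr p \<partial>N) powr (1 / p)"

definition configs :: "nat \<Rightarrow> (nat \<Rightarrow> real ^ 'n::finite) set" where
  "configs M = {1..M} \<rightarrow>\<^sub>E cube"

definition cover_fun :: "real \<Rightarrow> real \<Rightarrow> nat \<Rightarrow> (nat \<Rightarrow> real ^ 'n::finite) \<Rightarrow> real ^ 'n \<Rightarrow> real" where
  "cover_fun \<alpha> \<epsilon> M X x = (MIN m\<in>{1..M}. \<epsilon> + infnorm (x - X m) powr \<alpha>)"

lemma continuous_on_cover_fun:
  fixes X :: "nat \<Rightarrow> real ^ 'n::finite"
  assumes "\<alpha> > 0" "M \<ge> 1"
  shows "continuous_on S (cover_fun \<alpha> \<epsilon> M X)"
  using assms(2)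
proof (induction M rule: nat_induct_at_least)
  case base
  show ?case
    using assms(1) unfolding cover_fun_def
    by (auto intro!: continuous_intros continuous_on_powr' simp: infnorm_pos_le)
next
  case (Suc M)
  have "cover_fun \<alpha> \<epsilon> (Suc M) X =
      (\<lambda>x. min (\<epsilon> + infnorm (x - X (Suc M)) powr \<alpha>) (cover_fun \<alpha> \<epsilon> M X x))"
    using Suc.hyps by (auto simp: cover_fun_def atLeastAtMostSuc_conv fun_eq_iff)
  then show ?case
    using Suc.IH assms(1)
    by (auto intro!: continuous_intros continuous_on_powr' simp: infnorm_pos_le)
qed

lemma integrable_cover_fun:
  fixes X :: "nat \<Rightarrow> real ^ 'n::finite"
  assumes "\<alpha> > 0" "M \<ge> 1" "p > 0"
  shows "integrable cube_measure (\<lambda>x. \<bar>cover_fun \<alpha> \<epsilon> M X x\<bar> powr p)"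
proof -
  let ?f = "\<lambda>x. \<bar>cover_fun \<alpha> \<epsilon> M X x\<bar> powr p"
  have cont: "continuous_on S ?f" for S
    using assms by (auto intro!: continuous_intros continuous_on_powr' continuous_on_cover_fun)
  have meas: "?f \<in> borel_measurable borel"
    using cont by (rule borel_measurable_continuous_onI)
  have int: "integrable lborel (\<lambda>x. indicator cube x *\<^sub>R ?f x)"
    unfolding cube_def
    by (rule borel_integrable_compact[OF compact_cbox cont, unfolded set_integrable_def])
  have two: "emeasure lborel (cube :: (real ^ 'n) set) = ennreal (2 ^ CARD('n))"
    by (simp add: emeasure_lborel_cube flip: ennreal_power)
  have dens: "indicator cube x / emeasure lborel (cube :: (real ^ 'n) set) =
      ennreal (indicator cube x / 2 ^ CARD('n))" for x :: "real ^ 'n"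
    unfolding two by (subst divide_ennreal[symmetric]) (auto simp: ennreal_indicator)
  have "integrable lborel (\<lambda>x. (indicator cube x / 2 ^ CARD('n)) *\<^sub>R ?f x)"
    using integrable_mult_left[OF int, of "1 / 2 ^ CARD('n)"] by simp
  then show ?thesis
    using meas unfolding cube_measure_def uniform_measure_def dens
    by (subst integrable_density) (auto simp: cube_def)
qed

end

theory Submission
  imports Defs
begin

(* Put \<Phi> y = (\<epsilon> + |y|^\<alpha>)^p for the sup norm |.|, R = M^(-1/d) and T = \<Phi>(R), so that the p-th power of
   the cover function is the minimum of the M translates of \<Phi>. The deficit T - min \<Phi> is at most
   the sum of the M truncated deficits (T - \<Phi>)^+, each supported on a cube of half-side R; by the layer cake
   formula the integral of one of them is 2^d times the integral in the theorem. When M^(1/d) is an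
   integer, the M cubes around the points of the regular grid tile [-1,1]^d, and there the bound on
   the deficit is an identity. *)

section \<open>Powers, sup-norm balls and translation invariance\<close>

lemma powr_le_iff_le_powr_inverse:
  fixes x y p :: real
  assumes "0 \<le> x" "0 \<le> y" "0 < p"
  shows "x powr p \<le> y \<longleftrightarrow> x \<le> y powr (1 / p)"
proof -
  have "x \<le> y powr (1 / p)" if "x powr p \<le> y"
    using powr_mono2[of "1 / p" "x powr p" y] that assms by (simp add: powr_powr)
  moreover have "x powr p \<le> y" if "x \<le> y powr (1 / p)"
    using powr_mono2[of p x "y powr (1 / p)"] that assms by (simp add: powr_powr)
  ultimately show ?thesis by blast
qed

lemma infnorm_le_iff_cart: "infnorm x \<le> r \<longleftrightarrow> (\<forall>i. \<bar>x $ i\<bar> \<le> r)" for x :: "real ^ 'n::finite"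
proof -
  have "infnorm x = Max ((\<lambda>i. \<bar>x $ i\<bar>) ` UNIV)"
    unfolding infnorm_cart by (subst cSup_eq_Max) (auto simp: full_SetCompr_eq)
  then show ?thesis by simp
qed

text \<open>A sup-norm ball is a box, so its volume is exactly a power of its side; this is what
  makes the deficit integral explicit.\<close>

lemma emeasure_lborel_infnorm_le:
  assumes "0 \<le> r"
  shows "emeasure lborel {x :: real ^ 'n::finite. infnorm x \<le> r} = ennreal ((2 * r) ^ CARD('n))"
proof -
  let ?v = "(\<chi> i. r) :: real ^ 'n"
  have "{x :: real ^ 'n. infnorm x \<le> r} = cbox (- ?v) ?v"
    by (auto simp: infnorm_le_iff_cart mem_box_cart abs_le_iff minus_le_iff)
  moreover have "(\<Prod>b\<in>(Basis :: (real ^ 'n) set). (?v - - ?v) \<bullet> b) = (\<Prod>b\<in>(Basis :: (real ^ 'n) set). 2 * r)"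
    by (intro prod.cong) (auto simp: Basis_vec_def inner_axis)
  moreover have "(- ?v) \<bullet> b \<le> ?v \<bullet> b" if "b \<in> Basis" for b
    using that assms by (auto simp: Basis_vec_def inner_axis)
  ultimately show ?thesis
    by (simp add: emeasure_lborel_cbox_eq)
qed

text \<open>The deficit is integrated over all of R^n, where moving the centre changes nothing; the
  cube, which is not translation invariant, enters only afterwards.\<close>

lemma has_bochner_integral_lborel_translation:
  fixes g :: "'a::euclidean_space \<Rightarrow> real"
  assumes "has_bochner_integral lborel g K"
  shows "has_bochner_integral lborel (\<lambda>x. g (x - c)) K"
proof -
  have [measurable]: "g \<in> borel_measurable borel"
    using assms by (auto simp: has_bochner_integral_iff dest: borel_measurable_integrable)
  have "has_bochner_integral (distr lborel borel ((+) (- c))) g K"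
    using assms by (simp only: lborel_distr_plus)
  then show ?thesis
    by (simp add: has_bochner_integral_iff integrable_distr_eq integral_distr)
qed

section \<open>Integration against the normalized measure on the cube\<close>

text \<open>With a real-valued density, integrals against \<open>cube_measure\<close> reduce to
  Lebesgue integrals with the factor 1 / 2^d.\<close>

lemma cube_measure_eq_density:
  "(cube_measure :: (real ^ 'n::finite) measure) =
    density lborel (\<lambda>x. ennreal (indicator cube x / 2 ^ CARD('n)))"
proof -
  have two: "emeasure lborel (cube :: (real ^ 'n) set) = ennreal (2 ^ CARD('n))"
    by (simp add: emeasure_lborel_cube flip: ennreal_power)
  have "indicator cube x / emeasure lborel (cube :: (real ^ 'n) set) =
      ennreal (indicator cube x / 2 ^ CARD('n))" for x :: "real ^ 'n"
    unfolding two by (subst divide_ennreal[symmetric]) (auto simp: ennreal_indicator)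
  then show ?thesis
    by (simp add: cube_measure_def uniform_measure_def)
qed

lemma emeasure_cube_measure_UNIV: "emeasure (cube_measure :: (real ^ 'n::finite) measure) UNIV = 1"
  unfolding cube_measure_def
  by (subst emeasure_uniform_measure)
    (auto simp: cube_def emeasure_lborel_cube[unfolded cube_def] power_eq_top_ennreal less_top[symmetric]
      intro!: ennreal_divide_self)

lemma integral_cube_measure:
  fixes f :: "real ^ 'n::finite \<Rightarrow> real"
  assumes [measurable]: "f \<in> borel_measurable borel"
  shows "(\<integral>x. f x \<partial>cube_measure) = (\<integral>x. indicator cube x * f x \<partial>lborel) / 2 ^ CARD('n)"
proof -
  have "(\<integral>x. f x \<partial>cube_measure) = (\<integral>x. (indicator cube x * f x) / 2 ^ CARD('n) \<partial>lborel)"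
    unfolding cube_measure_eq_density by (subst integral_density) (auto simp: cube_def)
  then show ?thesis by simp
qed

lemma integrable_cube_measure:
  fixes f :: "real ^ 'n::finite \<Rightarrow> real"
  assumes "integrable lborel f"
  shows "integrable cube_measure f"
proof -
  have [measurable]: "f \<in> borel_measurable borel"
    using borel_measurable_integrable[OF assms] by simp
  have "integrable lborel (\<lambda>x. indicator cube x * f x / 2 ^ CARD('n))"
    using integrable_mult_indicator[OF _ assms, of cube] by (simp add: cube_def)
  then show ?thesis
    unfolding cube_measure_eq_density by (subst integrable_density) (auto simp: cube_def)
qed

section \<open>The truncated deficit of a single centre and its integral\<close>

text \<open>The function \<Phi> depends on y only through its sup norm; this is \<Phi> as a function
  of that radius.\<close>

definition profile :: "real \<Rightarrow> real \<Rightarrow> real \<Rightarrow> real \<Rightarrow> real" where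
  "profile \<alpha> \<epsilon> p r = (\<epsilon> + r powr \<alpha>) powr p"

text \<open>Cutting off at 0 confines the deficit to the cube of half-side R and makes it
  nonnegative, so that the deficits of several centres can be added without cancellation.\<close>

definition deficit :: "real \<Rightarrow> real \<Rightarrow> real \<Rightarrow> real \<Rightarrow> real ^ 'n::finite \<Rightarrow> real" where
  "deficit \<alpha> \<epsilon> p R y = max 0 (profile \<alpha> \<epsilon> p R - profile \<alpha> \<epsilon> p (infnorm y))"

lemma profile_mono:
  assumes "0 \<le> \<alpha>" "0 \<le> \<epsilon>" "0 \<le> p" "0 \<le> r" "r \<le> s"
  shows "profile \<alpha> \<epsilon> p r \<le> profile \<alpha> \<epsilon> p s"
  unfolding profile_def using assms by (intro powr_mono2 add_mono add_nonneg_nonneg) auto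

text \<open>Two inversions of powers turn the sublevel sets of \<Phi> into sup-norm balls. The bound
  \<epsilon>^p \<le> t keeps t^(1/p) - \<epsilon> nonnegative for the second inversion.\<close>

lemma profile_le_iff:
  assumes "0 < \<alpha>" "0 \<le> \<epsilon>" "0 < p" "0 \<le> r" "\<epsilon> powr p \<le> t"
  shows "profile \<alpha> \<epsilon> p r \<le> t \<longleftrightarrow> r \<le> (t powr (1 / p) - \<epsilon>) powr (1 / \<alpha>)"
proof -
  have t: "0 \<le> t" using assms(5) powr_ge_zero[of \<epsilon> p] by linarith
  then have "\<epsilon> \<le> t powr (1 / p)"
    using assms by (simp flip: powr_le_iff_le_powr_inverse)
  moreover have "profile \<alpha> \<epsilon> p r \<le> t \<longleftrightarrow> r powr \<alpha> \<le> t powr (1 / p) - \<epsilon>"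
    unfolding profile_def using assms t by (subst powr_le_iff_le_powr_inverse) auto
  ultimately show ?thesis
    using assms by (simp add: powr_le_iff_le_powr_inverse)
qed

text \<open>By monotonicity the deficit vanishes from radius R on, R included. The strict inequality
  lets neighbouring cubes of a tiling share boundary points.\<close>

lemma infnorm_less_if_deficit_nonzero:
  assumes "0 \<le> \<alpha>" "0 \<le> \<epsilon>" "0 \<le> p" "0 \<le> R" "deficit \<alpha> \<epsilon> p R y \<noteq> 0"
  shows "infnorm y < R"
  using profile_mono[of \<alpha> \<epsilon> p R "infnorm y"] assms by (force simp: deficit_def)

lemma continuous_on_deficit:
  assumes "0 < \<alpha>" "0 \<le> \<epsilon>" "0 < p"
  shows "continuous_on S (deficit \<alpha> \<epsilon> p R)"
  unfolding deficit_def profile_def using assms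
  by (auto intro!: continuous_intros continuous_on_powr' simp: infnorm_pos_le)

text \<open>Layer cake: the deficit at y is the length of the interval from \<Phi>(y) to T, so
  exchanging the integrals leaves the volumes of the sublevel sets of \<Phi>. These are cubes of
  half-side (t^(1/p) - \<epsilon>)^(1/\<alpha>).\<close>

lemma has_bochner_integral_deficit:
  fixes \<alpha> \<epsilon> p R :: real
  defines "T \<equiv> profile \<alpha> \<epsilon> p R"
  assumes "0 < \<alpha>" "0 \<le> \<epsilon>" "0 < p" "0 \<le> R"
  shows "has_bochner_integral lborel (deficit \<alpha> \<epsilon> p R :: real ^ 'n::finite \<Rightarrow> real)
    (2 ^ CARD('n) * (LBINT t:{\<epsilon> powr p..T}. (t powr (1 / p) - \<epsilon>) powr (real CARD('n) / \<alpha>)))"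
proof -
  define q where "q = real CARD('n) / \<alpha>"
  define \<psi> where "\<psi> = (\<lambda>t::real. (t powr (1 / p) - \<epsilon>) powr q)"
  let ?\<Phi> = "\<lambda>y :: real ^ 'n. profile \<alpha> \<epsilon> p (infnorm y)"
  have q: "0 < q" using assms by (simp add: q_def)
  have base: "0 \<le> t powr (1 / p) - \<epsilon>" "0 \<le> t" if "\<epsilon> powr p \<le> t" for t
  proof -
    show "0 \<le> t" using that powr_ge_zero[of \<epsilon> p] by linarith
    then show "0 \<le> t powr (1 / p) - \<epsilon>"
      using that assms by (simp flip: powr_le_iff_le_powr_inverse)
  qed
  have "continuous_on UNIV ?\<Phi>"
    unfolding profile_def using assms
    by (auto intro!: continuous_intros continuous_on_powr' simp: infnorm_pos_le)
  then have [measurable]: "?\<Phi> \<in> borel_measurable borel"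
    by (rule borel_measurable_continuous_onI)
  have [measurable]: "(deficit \<alpha> \<epsilon> p R :: real ^ 'n \<Rightarrow> real) \<in> borel_measurable borel"
    using assms by (intro borel_measurable_continuous_onI continuous_on_deficit)
  have cont: "continuous_on {\<epsilon> powr p..T} \<psi>"
    unfolding \<psi>_def using assms q base
    by (intro continuous_on_powr' continuous_intros) auto
  have int: "set_integrable lborel {\<epsilon> powr p..T} \<psi>"
    using cont by (rule borel_integrable_atLeastAtMost')
  \<comment> \<open>Below \<epsilon>^p the sublevel sets are empty, whence the lower limit of
    integration.\<close>
  have lower: "\<epsilon> powr p \<le> ?\<Phi> y" for y
    unfolding profile_def using assms by (intro powr_mono2) auto
  have vol: "emeasure lborel {y :: real ^ 'n. ?\<Phi> y \<le> t} = ennreal (2 ^ CARD('n) * \<psi> t)"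
    if "\<epsilon> powr p \<le> t" for t
  proof -
    have "{y :: real ^ 'n. ?\<Phi> y \<le> t} = {y. infnorm y \<le> (t powr (1 / p) - \<epsilon>) powr (1 / \<alpha>)}"
      using assms that by (simp add: profile_le_iff infnorm_pos_le)
    \<comment> \<open>This includes t = \<epsilon>^p, where the base is 0, because the dimension is
      positive.\<close>
    moreover have "((t powr (1 / p) - \<epsilon>) powr (1 / \<alpha>)) ^ CARD('n) = \<psi> t"
      unfolding \<psi>_def q_def by (simp add: powr_powr flip: powr_realpow')
    ultimately show ?thesis
      by (simp add: emeasure_lborel_infnorm_le power_mult_distrib)
  qed
  \<comment> \<open>The nonnegative integral allows the exchange with measurability alone. If
    \<Phi>(y) > T, the interval is empty and the deficit is 0.\<close>
  have "(\<integral>\<^sup>+y. ennreal (deficit \<alpha> \<epsilon> p R y) \<partial>(lborel :: (real ^ 'n) measure))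
      = (\<integral>\<^sup>+y. (\<integral>\<^sup>+t. indicator {(y, t). ?\<Phi> y \<le> t \<and> t \<le> T} (y, t) \<partial>lborel) \<partial>lborel)"
  proof (intro nn_integral_cong)
    fix y :: "real ^ 'n"
    have "(\<integral>\<^sup>+t. indicator {(y, t). ?\<Phi> y \<le> t \<and> t \<le> T} (y, t) \<partial>lborel)
        = (\<integral>\<^sup>+t. indicator {?\<Phi> y..T} t \<partial>lborel)"
      by (intro nn_integral_cong) (auto simp: indicator_def)
    also have "\<dots> = ennreal (deficit \<alpha> \<epsilon> p R y)"
      by (auto simp: deficit_def T_def emeasure_lborel_Icc_eq)
    finally show "ennreal (deficit \<alpha> \<epsilon> p R y)
        = (\<integral>\<^sup>+t. indicator {(y, t). ?\<Phi> y \<le> t \<and> t \<le> T} (y, t) \<partial>lborel)" ..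
  qed
  also have "\<dots> = (\<integral>\<^sup>+t. (\<integral>\<^sup>+y. indicator {(y, t). ?\<Phi> y \<le> t \<and> t \<le> T} (y, t) \<partial>lborel) \<partial>lborel)"
    by (rule lborel_pair.Fubini'[symmetric]) measurable
  also have "\<dots> = (\<integral>\<^sup>+t. ennreal (2 ^ CARD('n) * (indicator {\<epsilon> powr p..T} t * \<psi> t)) \<partial>lborel)"
  proof (intro nn_integral_cong)
    fix t :: real
    show "(\<integral>\<^sup>+y. indicator {(y, t). ?\<Phi> y \<le> t \<and> t \<le> T} (y, t) \<partial>lborel)
        = ennreal (2 ^ CARD('n) * (indicator {\<epsilon> powr p..T} t * \<psi> t))"
    proof (cases "t \<in> {\<epsilon> powr p..T}")
      case True
      then have "(\<integral>\<^sup>+y. indicator {(y, t). ?\<Phi> y \<le> t \<and> t \<le> T} (y, t) \<partial>lborel)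
          = (\<integral>\<^sup>+y. indicator {y. ?\<Phi> y \<le> t} y \<partial>lborel)"
        by (intro nn_integral_cong) (auto simp: indicator_def)
      then show ?thesis using True vol[of t] by simp
    next
      case False
      then have "\<not> (?\<Phi> y \<le> t \<and> t \<le> T)" for y
        using lower[of y] by auto
      then show ?thesis using False by simp
    qed
  qed
  also have "\<dots> = ennreal (\<integral>t. 2 ^ CARD('n) * (indicator {\<epsilon> powr p..T} t * \<psi> t) \<partial>lborel)"
    using int by (intro nn_integral_eq_integral)
      (auto simp: set_integrable_def \<psi>_def)
  also have "\<dots> = ennreal (2 ^ CARD('n) * (LBINT t:{\<epsilon> powr p..T}. \<psi> t))"
    by (simp add: set_lebesgue_integral_def)
  finally have "(\<integral>\<^sup>+y. ennreal (deficit \<alpha> \<epsilon> p R y) \<partial>(lborel :: (real ^ 'n) measure))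
      = ennreal (2 ^ CARD('n) * (LBINT t:{\<epsilon> powr p..T}. \<psi> t))" .
  moreover have "0 \<le> (LBINT t:{\<epsilon> powr p..T}. \<psi> t)"
    unfolding set_lebesgue_integral_def by (intro integral_nonneg_AE) (auto simp: \<psi>_def)
  ultimately show ?thesis
    unfolding \<psi>_def q_def
    by (intro has_bochner_integral_nn_integral) (auto simp: deficit_def)
qed

text \<open>Against \<open>cube_measure\<close> the integral is the whole-space one divided by 2^d,
  less the part of the translated support that sticks out of the cube. This loss gives the
  inequality, its absence the equality.\<close>

lemma integral_deficit:
  fixes c :: "real ^ 'n::finite"
  assumes "0 < \<alpha>" "0 \<le> \<epsilon>" "0 < p" "0 \<le> R"
  defines "I \<equiv> (LBINT t:{\<epsilon> powr p..profile \<alpha> \<epsilon> p R}. (t powr (1 / p) - \<epsilon>) powr (real CARD('n) / \<alpha>))"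
  shows "integrable cube_measure (\<lambda>x. deficit \<alpha> \<epsilon> p R (x - c))"
    and "(\<integral>x. deficit \<alpha> \<epsilon> p R (x - c) \<partial>cube_measure) \<le> I"
    and "(\<And>x. infnorm (x - c) < R \<Longrightarrow> x \<in> cube) \<Longrightarrow>
      (\<integral>x. deficit \<alpha> \<epsilon> p R (x - c) \<partial>cube_measure) = I"
proof -
  let ?g = "\<lambda>x. deficit \<alpha> \<epsilon> p R (x - c)"
  have bochner: "has_bochner_integral lborel ?g (2 ^ CARD('n) * I)"
    unfolding I_def using assms
    by (intro has_bochner_integral_lborel_translation has_bochner_integral_deficit)
  then have int: "integrable lborel ?g" and val: "(\<integral>x. ?g x \<partial>lborel) = 2 ^ CARD('n) * I"
    by (auto simp: has_bochner_integral_iff)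
  show "integrable cube_measure ?g"
    using int by (rule integrable_cube_measure)
  have eq: "(\<integral>x. ?g x \<partial>cube_measure) = (\<integral>x. indicator cube x * ?g x \<partial>lborel) / 2 ^ CARD('n)"
    using borel_measurable_integrable[OF int] by (intro integral_cube_measure) simp
  have "(\<integral>x. indicator cube x * ?g x \<partial>lborel) \<le> (\<integral>x. ?g x \<partial>lborel)"
    using integrable_mult_indicator[OF _ int, of cube] int
    by (intro integral_mono) (auto simp: cube_def deficit_def split: split_indicator)
  then show "(\<integral>x. ?g x \<partial>cube_measure) \<le> I"
    unfolding eq val by (simp add: field_simps)
  assume "\<And>x. infnorm (x - c) < R \<Longrightarrow> x \<in> cube"
  then have "(\<lambda>x. indicator cube x * ?g x) = ?g"
    using infnorm_less_if_deficit_nonzero[of \<alpha> \<epsilon> p R] assms by (force simp: fun_eq_iff split: split_indicator)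
  then show "(\<integral>x. ?g x \<partial>cube_measure) = I"
    unfolding eq using val by simp
qed

section \<open>From the deficits to the norm of the cover function\<close>

lemma cover_fun_powr_le:
  assumes "0 \<le> \<epsilon>" "0 \<le> p" "m \<in> {1..M}"
  shows "\<bar>cover_fun \<alpha> \<epsilon> M X x\<bar> powr p \<le> profile \<alpha> \<epsilon> p (infnorm (x - X m))"
proof -
  have "0 \<le> cover_fun \<alpha> \<epsilon> M X x"
    unfolding cover_fun_def using assms by (subst Min_ge_iff) auto
  moreover have "cover_fun \<alpha> \<epsilon> M X x \<le> \<epsilon> + infnorm (x - X m) powr \<alpha>"
    unfolding cover_fun_def using assms by (intro Min_le) auto
  ultimately show ?thesis
    unfolding profile_def using assms by (auto intro: powr_mono2)
qed

lemma cover_fun_powr_attained: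
  assumes "0 \<le> \<epsilon>" "1 \<le> M"
  obtains m where "m \<in> {1..M}"
    "\<bar>cover_fun \<alpha> \<epsilon> M X x\<bar> powr p = profile \<alpha> \<epsilon> p (infnorm (x - X m))"
proof -
  have "cover_fun \<alpha> \<epsilon> M X x \<in> (\<lambda>m. \<epsilon> + infnorm (x - X m) powr \<alpha>) ` {1..M}"
    unfolding cover_fun_def using assms by (intro Min_in) auto
  then obtain m where "m \<in> {1..M}" "cover_fun \<alpha> \<epsilon> M X x = \<epsilon> + infnorm (x - X m) powr \<alpha>"
    by auto
  then show ?thesis
    using assms by (intro that) (auto simp: profile_def)
qed

lemma Lp_norm_nonneg: "0 \<le> Lp_norm N p f"
  by (simp add: Lp_norm_def)

lemma Lp_norm_powr: "0 < p \<Longrightarrow> Lp_norm N p f powr p = (\<integral>x. \<bar>f x\<bar> powr p \<partial>N)"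
  by (simp add: Lp_norm_def powr_powr)

text \<open>The cube measure has total mass 1, so the constant T integrates to T, and bounds on the
  integrated deficit become bounds on the norm.\<close>

lemma integral_const_minus_cover_fun_powr:
  fixes X :: "nat \<Rightarrow> real ^ 'n::finite"
  assumes "0 < \<alpha>" "0 < p" "1 \<le> M"
  shows "integrable cube_measure (\<lambda>x. T - \<bar>cover_fun \<alpha> \<epsilon> M X x\<bar> powr p)"
    and "(\<integral>x. T - \<bar>cover_fun \<alpha> \<epsilon> M X x\<bar> powr p \<partial>cube_measure)
      = T - (\<integral>x. \<bar>cover_fun \<alpha> \<epsilon> M X x\<bar> powr p \<partial>cube_measure)"
proof -
  have space: "space (cube_measure :: (real ^ 'n) measure) = UNIV"
    by (simp add: cube_measure_def)
  interpret finite_measure "cube_measure :: (real ^ 'n) measure"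
    by standard (simp add: space emeasure_cube_measure_UNIV)
  have sp: "measure (cube_measure :: (real ^ 'n) measure) (space cube_measure) = 1"
    by (simp add: space measure_def emeasure_cube_measure_UNIV)
  show "integrable cube_measure (\<lambda>x. T - \<bar>cover_fun \<alpha> \<epsilon> M X x\<bar> powr p)"
    using assms by (intro Bochner_Integration.integrable_diff integrable_cover_fun) auto
  show "(\<integral>x. T - \<bar>cover_fun \<alpha> \<epsilon> M X x\<bar> powr p \<partial>cube_measure)
      = T - (\<integral>x. \<bar>cover_fun \<alpha> \<epsilon> M X x\<bar> powr p \<partial>cube_measure)"
    using assms by (subst Bochner_Integration.integral_diff) (auto simp: integrable_cover_fun sp)
qed

text \<open>Integrates the pointwise bound of the deficit by the sum over all centres. It holds for
  every cut-off radius R; the choice of R in terms of M is made in the final proof.\<close>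

lemma Lp_norm_cover_fun_ge:
  fixes X :: "nat \<Rightarrow> real ^ 'n::finite"
  assumes "0 < \<alpha>" "0 < p" "1 \<le> M" "0 \<le> \<epsilon>" "0 \<le> R"
  shows "profile \<alpha> \<epsilon> p R - real M * (LBINT t:{\<epsilon> powr p..profile \<alpha> \<epsilon> p R}.
      (t powr (1 / p) - \<epsilon>) powr (real CARD('n) / \<alpha>))
    \<le> Lp_norm cube_measure p (cover_fun \<alpha> \<epsilon> M X) powr p" (is "?T - real M * ?I \<le> _")
proof -
  let ?C = "\<lambda>x. \<bar>cover_fun \<alpha> \<epsilon> M X x\<bar> powr p"
  have int: "integrable cube_measure (\<lambda>x. \<Sum>m=1..M. deficit \<alpha> \<epsilon> p R (x - X m))"
    using assms by (intro Bochner_Integration.integrable_sum integral_deficit)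
  have "?T - ?C x \<le> (\<Sum>m=1..M. deficit \<alpha> \<epsilon> p R (x - X m))" for x
  proof -
    obtain m where m: "m \<in> {1..M}" "?C x = profile \<alpha> \<epsilon> p (infnorm (x - X m))"
      using cover_fun_powr_attained[OF assms(4,3)] by blast
    \<comment> \<open>The centre attaining the minimum already accounts for the deficit; the other
      summands are nonnegative.\<close>
    then have "?T - ?C x \<le> deficit \<alpha> \<epsilon> p R (x - X m)"
      by (simp add: deficit_def)
    also have "\<dots> \<le> (\<Sum>m=1..M. deficit \<alpha> \<epsilon> p R (x - X m))"
      using m(1) by (intro member_le_sum) (auto simp: deficit_def)
    finally show ?thesis .
  qed
  then have "(\<integral>x. ?T - ?C x \<partial>cube_measure)
      \<le> (\<integral>x. (\<Sum>m=1..M. deficit \<alpha> \<epsilon> p R (x - X m)) \<partial>cube_measure)"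
    using assms int by (intro integral_mono integral_const_minus_cover_fun_powr)
  also have "\<dots> = (\<Sum>m=1..M. (\<integral>x. deficit \<alpha> \<epsilon> p R (x - X m) \<partial>cube_measure))"
    using assms by (intro Bochner_Integration.integral_sum integral_deficit)
  also have "\<dots> \<le> (\<Sum>m=1..M. ?I)"
    using assms by (intro sum_mono integral_deficit)
  finally show ?thesis
    using assms by (simp add: integral_const_minus_cover_fun_powr Lp_norm_powr)
qed

text \<open>The three geometric hypotheses remove the three losses of the lower bound: points where
  the minimum exceeds T, supports leaving the cube, and overlaps. Closed cubes must cover, but only
  open ones be disjoint, since the deficit vanishes on the boundary.\<close>

lemma Lp_norm_cover_fun_eq:
  fixes X :: "nat \<Rightarrow> real ^ 'n::finite"
  assumes params: "0 < \<alpha>" "0 < p" "1 \<le> M" "0 \<le> \<epsilon>" "0 \<le> R"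
    and cover: "\<And>x. x \<in> cube \<Longrightarrow> \<exists>m\<in>{1..M}. infnorm (x - X m) \<le> R"
    and inside: "\<And>m x. m \<in> {1..M} \<Longrightarrow> infnorm (x - X m) < R \<Longrightarrow> x \<in> cube"
    and disjoint: "\<And>m m' x. \<lbrakk>m \<in> {1..M}; m' \<in> {1..M}; infnorm (x - X m) < R; infnorm (x - X m') < R\<rbrakk>
      \<Longrightarrow> m = m'"
  shows "Lp_norm cube_measure p (cover_fun \<alpha> \<epsilon> M X) powr p =
    profile \<alpha> \<epsilon> p R - real M * (LBINT t:{\<epsilon> powr p..profile \<alpha> \<epsilon> p R}.
      (t powr (1 / p) - \<epsilon>) powr (real CARD('n) / \<alpha>))" (is "_ = ?T - real M * ?I")
proof -
  let ?C = "\<lambda>x. \<bar>cover_fun \<alpha> \<epsilon> M X x\<bar> powr p"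
  let ?D = "\<lambda>x. \<Sum>m=1..M. deficit \<alpha> \<epsilon> p R (x - X m)"
  have pointwise: "?T - ?C x = ?D x" if x: "x \<in> cube" for x
  proof -
    obtain m where m: "m \<in> {1..M}" "?C x = profile \<alpha> \<epsilon> p (infnorm (x - X m))"
      using cover_fun_powr_attained[OF params(4,3)] by blast
    obtain k where k: "k \<in> {1..M}" "infnorm (x - X k) \<le> R"
      using cover[OF x] by blast
    \<comment> \<open>Since the closed cubes cover, the minimum is at most T and the truncation at 0
      is inactive for the minimizing centre.\<close>
    have "?C x \<le> profile \<alpha> \<epsilon> p (infnorm (x - X k))"
      using params k by (intro cover_fun_powr_le) auto
    also have "\<dots> \<le> ?T"
      using params k by (intro profile_mono) (auto simp: infnorm_pos_le)
    finally have CT: "?C x \<le> ?T" .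
    \<comment> \<open>A nonzero deficit at l means \<Phi>(x - X l) < T. The value at the minimizing
      m is no larger, so the deficit at m is nonzero too and x lies in both open cubes.\<close>
    have "deficit \<alpha> \<epsilon> p R (x - X l) = 0" if l: "l \<in> {1..M}" "l \<noteq> m" for l
    proof (rule ccontr)
      assume nz: "deficit \<alpha> \<epsilon> p R (x - X l) \<noteq> 0"
      then have "profile \<alpha> \<epsilon> p (infnorm (x - X l)) < ?T"
        by (auto simp: deficit_def max_def split: if_splits)
      moreover have "?C x \<le> profile \<alpha> \<epsilon> p (infnorm (x - X l))"
        using params l by (intro cover_fun_powr_le) auto
      ultimately have "deficit \<alpha> \<epsilon> p R (x - X m) \<noteq> 0"
        using m by (simp add: deficit_def)
      then have "l = m"
        using nz params m(1) l by (intro disjoint[of l m x] infnorm_less_if_deficit_nonzero[of \<alpha> \<epsilon> p]) auto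
      then show False using l by simp
    qed
    then have "?D x = (\<Sum>l\<in>{1..M}. if l = m then deficit \<alpha> \<epsilon> p R (x - X m) else 0)"
      by (intro sum.cong) auto
    also have "\<dots> = deficit \<alpha> \<epsilon> p R (x - X m)"
      using m by simp
    finally show ?thesis
      using CT m by (simp add: deficit_def)
  qed
  have int: "integrable cube_measure ?D"
    using params by (intro Bochner_Integration.integrable_sum integral_deficit)
  note intC = integral_const_minus_cover_fun_powr[OF params(1,2,3), of ?T \<epsilon> X]
  have "?T - (\<integral>x. ?C x \<partial>cube_measure) = (\<integral>x. ?T - ?C x \<partial>cube_measure)"
    using intC by simp
  also have "\<dots> = (\<integral>x. ?D x \<partial>cube_measure)"
  proof (rule integral_cong_AE)
    \<comment> \<open>The identity is known only on the cube, whose complement is a null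
      set.\<close>
    show "AE x in cube_measure. ?T - ?C x = ?D x"
      unfolding cube_measure_def
      by (rule AE_uniform_measureI) (auto simp: cube_def pointwise[unfolded cube_def])
  qed (use int intC(1) in auto)
  also have "\<dots> = (\<Sum>m=1..M. (\<integral>x. deficit \<alpha> \<epsilon> p R (x - X m) \<partial>cube_measure))"
    using params by (intro Bochner_Integration.integral_sum integral_deficit)
  also have "\<dots> = (\<Sum>m=1..M. ?I)"
    using params inside by (intro sum.cong integral_deficit(3) refl) auto
  finally show ?thesis
    using params by (simp add: Lp_norm_powr algebra_simps)
qed

section \<open>The regular grid of k^d points\<close>

text \<open>The points -1 + (2j + 1)/k are the midpoints of the k intervals of length 2/k that
  divide [-1,1].\<close>

lemma grid_point_near:
  fixes x :: real
  assumes "1 \<le> k" "\<bar>x\<bar> \<le> 1"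
  obtains j :: nat where "j < k" "\<bar>x - (-1 + (2 * real j + 1) / real k)\<bar> \<le> 1 / real k"
proof -
  \<comment> \<open>This rescales [-1,1] to [0,k], with the intervals becoming [j, j + 1].\<close>
  define y where "y = real k * (x + 1) / 2"
  have y: "0 \<le> y" "y \<le> real k"
    using assms by (auto simp: y_def abs_le_iff mult_le_cancel_left)
  \<comment> \<open>The minimum matters only at x = 1, where the floor is k and the last interval
    has to be used.\<close>
  define j where "j = min (k - 1) (nat \<lfloor>y\<rfloor>)"
  have j: "j < k" "real j \<le> y" "y \<le> real j + 1"
    using assms y unfolding j_def by linarith+
  have "x - (-1 + (2 * real j + 1) / real k) = (2 * y - 2 * real j - 1) / real k"
    using assms by (simp add: y_def field_simps)
  also have "\<bar>\<dots>\<bar> \<le> 1 / real k"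
    using assms j by (simp add: divide_right_mono)
  finally show ?thesis using j that by blast
qed

text \<open>Takes all points whose coordinates are midpoints of the one-dimensional division. The
  conclusions are admissibility of the configuration and the hypotheses of
  \<open>Lp_norm_cover_fun_eq\<close> with R = 1/k.\<close>

lemma cube_grid:
  assumes "1 \<le> k"
  obtains X where "X \<in> (configs (k ^ CARD('n)) :: (nat \<Rightarrow> real ^ 'n::finite) set)"
    and "\<And>x. x \<in> cube \<Longrightarrow> \<exists>m\<in>{1..k ^ CARD('n)}. infnorm (x - X m) \<le> 1 / real k"
    and "\<And>m x. m \<in> {1..k ^ CARD('n)} \<Longrightarrow> infnorm (x - X m) < 1 / real k \<Longrightarrow> x \<in> cube"
    and "\<And>m m' x. \<lbrakk>m \<in> {1..k ^ CARD('n)}; m' \<in> {1..k ^ CARD('n)};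
        infnorm (x - X m) < 1 / real k; infnorm (x - X m') < 1 / real k\<rbrakk> \<Longrightarrow> m = m'"
proof -
  define M where "M = k ^ CARD('n)"
  define J where "J = (UNIV :: 'n set) \<rightarrow>\<^sub>E {..<k}"
  have "finite J" "card J = M"
    unfolding J_def M_def by (auto simp: finite_PiE card_PiE)
  then obtain h where h: "bij_betw h {1..M} J"
    using ex_bij_betw_nat_finite_1 by blast
  define c :: "('n \<Rightarrow> nat) \<Rightarrow> real ^ 'n" where
    "c j = (\<chi> i. -1 + (2 * real (j i) + 1) / real k)" for j
  \<comment> \<open>The restriction to {1..M} makes X extensional, as \<open>configs\<close>
    demands.\<close>
  define X where "X = (\<lambda>m\<in>{1..M}. c (h m))"
  have hJ: "h m i < k" if "m \<in> {1..M}" for m i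
    using bij_betwE[OF h] that by (auto simp: J_def PiE_iff)
  have near: "\<bar>x $ i - c (h m) $ i\<bar> < 1 / real k"
    if "m \<in> {1..M}" "infnorm (x - X m) < 1 / real k" for m x i
    using component_le_infnorm_cart[of "x - X m" i] that by (simp add: X_def)
  \<comment> \<open>Every centre keeps distance 1/k from the faces, so the open cube around it stays
    in [-1,1]^d.\<close>
  have bounds: "-1 + 1 / real k \<le> c (h m) $ i" "c (h m) $ i \<le> 1 - 1 / real k"
    if "m \<in> {1..M}" for m i
  proof -
    have le: "2 * real (h m i) + 2 \<le> 2 * real k"
      using hJ[OF that, of i] by linarith
    have "-1 + 1 / real k + 2 * real (h m i) / real k = c (h m) $ i"
      by (simp add: c_def add_divide_distrib)
    moreover have "(2 * real (h m i) + 2) / real k \<le> 2"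
      using le assms by (simp add: field_simps)
    moreover have "0 \<le> 2 * real (h m i) / real k" by simp
    ultimately show "-1 + 1 / real k \<le> c (h m) $ i" "c (h m) $ i \<le> 1 - 1 / real k"
      unfolding add_divide_distrib by linarith+
  qed
  show ?thesis
  proof (rule that[of X], fold M_def)
    have "c (h m) \<in> cube" if "m \<in> {1..M}" for m
      unfolding mem_cube_iff
    proof
      fix i
      show "c (h m) $ i \<in> {- 1..1}"
        using bounds[OF that, of i] zero_le_divide_1_iff[of "real k"] unfolding atLeastAtMost_iff by linarith
    qed
    then show "X \<in> configs M"
      by (auto simp: configs_def X_def)
  next
    fix x :: "real ^ 'n" assume x: "x \<in> cube"
    have "\<exists>j<k. \<bar>x $ i - (-1 + (2 * real j + 1) / real k)\<bar> \<le> 1 / real k" for i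
    proof -
      have "\<bar>x $ i\<bar> \<le> 1"
        using x by (auto simp: mem_cube_iff abs_le_iff minus_le_iff)
      then show ?thesis
        using grid_point_near[OF assms] by metis
    qed
    then obtain j where j: "\<And>i. j i < k"
        "\<And>i. \<bar>x $ i - (-1 + (2 * real (j i) + 1) / real k)\<bar> \<le> 1 / real k"
      by metis
    then have "j \<in> h ` {1..M}"
      using bij_betw_imp_surj_on[OF h] by (auto simp: J_def)
    then obtain m where "m \<in> {1..M}" "h m = j" by auto
    then show "\<exists>m\<in>{1..M}. infnorm (x - X m) \<le> 1 / real k"
      using j(2) by (intro bexI[of _ m]) (auto simp: infnorm_le_iff_cart X_def c_def)
  next
    fix m x assume m: "m \<in> {1..M}" "infnorm (x - X m) < 1 / real k"
    show "x \<in> cube"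
      unfolding mem_cube_iff
    proof
      fix i
      show "x $ i \<in> {-1..1}"
        using near[OF m, of i] bounds[OF m(1), of i] unfolding atLeastAtMost_iff by linarith
    qed
  next
    fix m m' x
    assume m: "m \<in> {1..M}" and m': "m' \<in> {1..M}"
      and n: "infnorm (x - X m) < 1 / real k" and n': "infnorm (x - X m') < 1 / real k"
    \<comment> \<open>Coordinates of two centres differ by an integer multiple of 2/k; a common
      point of the open cubes makes the difference smaller than 2/k, hence 0.\<close>
    have "h m i = h m' i" for i
    proof -
      have "\<bar>c (h m) $ i - c (h m') $ i\<bar> < 2 / real k"
        using near[OF m n, of i] near[OF m' n', of i] by linarith
      moreover have "c (h m) $ i - c (h m') $ i = 2 * (real (h m i) - real (h m' i)) / real k"
        by (simp add: c_def diff_divide_distrib add_divide_distrib right_diff_distrib)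
      ultimately have "\<bar>real (h m i) - real (h m' i)\<bar> < 1"
        using assms by (simp add: abs_mult divide_less_cancel)
      then show ?thesis by linarith
    qed
    then have "h m = h m'" ..
    then show "m = m'"
      using bij_betw_imp_inj_on[OF h] m m' by (auto dest: inj_onD)
  qed
qed

section \<open>Evaluation of the bound for \<epsilon> = 0\<close>

lemma set_integral_powr_from_0:
  fixes q T :: real
  assumes "0 < q" "0 \<le> T"
  shows "(LBINT t:{0..T}. t powr q) = T powr (q + 1) / (q + 1)"
proof -
  have "set_integrable lborel {0..T} (\<lambda>t. t powr q)"
    using assms
    by (intro borel_integrable_atLeastAtMost' continuous_on_powr' continuous_intros) auto
  then have "(LBINT t:{0..T}. t powr q) = integral {0..T} (\<lambda>t. t powr q)"
    by (rule set_borel_integral_eq_integral)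
  also have "\<dots> = T powr (q + 1) / (q + 1)"
    using assms by (intro integral_unique has_integral_powr_from_0) auto
  finally show ?thesis .
qed

text \<open>The integrand is t^q with q = d/(\<alpha> p), and T^q = 1/M by the choice of T. The
  factor M thus cancels and T - T/(q + 1) remains.\<close>

lemma cover_bound_eps_zero:
  fixes \<alpha> p d :: real
  assumes "0 < \<alpha>" "0 < p" "1 \<le> M" "0 < d"
  defines "T \<equiv> (1 / real M powr (\<alpha> / d)) powr p"
  shows "T - real M * (LBINT t:{0..T}. (t powr (1 / p)) powr (d / \<alpha>)) = d / (d + \<alpha> * p) * T"
proof -
  define q where "q = d / (\<alpha> * p)"
  have q: "0 < q" using assms by (simp add: q_def)
  have T: "0 < T" using assms by (simp add: T_def)
  have "(LBINT t:{0..T}. (t powr (1 / p)) powr (d / \<alpha>)) = (LBINT t:{0..T}. t powr q)"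
    by (simp add: powr_powr q_def mult.commute)
  also have "\<dots> = T powr (q + 1) / (q + 1)"
    using q T by (intro set_integral_powr_from_0) auto
  also have "T powr (q + 1) = T / real M"
  proof -
    have "T = real M powr (- (\<alpha> / d * p))"
      using assms by (simp add: T_def powr_divide powr_powr powr_minus_divide)
    then have "T powr q = real M powr (- 1)"
      using assms by (simp add: powr_powr q_def)
    then show ?thesis
      using T assms by (simp add: powr_add powr_minus_divide)
  qed
  finally have "T - real M * (LBINT t:{0..T}. (t powr (1 / p)) powr (d / \<alpha>)) = T - T / (q + 1)"
    using assms by simp
  also have "\<dots> = d / (d + \<alpha> * p) * T"
  proof -
    have "q + 1 = (d + \<alpha> * p) / (\<alpha> * p)"
      using assms by (simp add: q_def field_simps)
    then have "T / (q + 1) = T * (\<alpha> * p / (d + \<alpha> * p))"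
      by simp
    moreover have "1 - \<alpha> * p / (d + \<alpha> * p) = d / (d + \<alpha> * p)"
      using assms by (simp add: field_simps add_pos_pos less_imp_neq[symmetric])
    ultimately show ?thesis by (metis mult.commute mult.right_neutral right_diff_distrib)
  qed
  finally show ?thesis .
qed

section \<open>The infimum over all configurations\<close>

theorem theorem7:
  fixes \<alpha> p \<epsilon> d :: real and M :: nat
  assumes "0 < \<alpha>" "\<alpha> \<le> 1" and "1 \<le> p" and "1 \<le> M" and "0 \<le> \<epsilon>"
    and d: "d = real CARD('n::finite)"
  shows "((INF X \<in> (configs M :: (nat \<Rightarrow> real ^ 'n) set).
              (Lp_norm cube_measure p (cover_fun \<alpha> \<epsilon> M X)) powr p)
            \<ge> (\<epsilon> + 1 / real M powr (\<alpha> / d)) powr p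
              - real M * (LBINT t:{\<epsilon> powr p..(\<epsilon> + 1 / real M powr (\<alpha> / d)) powr p}.
                  (t powr (1 / p) - \<epsilon>) powr (d / \<alpha>)))
       \<and> (real M powr (1 / d) \<in> \<int> \<longrightarrow>
            (INF X \<in> (configs M :: (nat \<Rightarrow> real ^ 'n) set).
              (Lp_norm cube_measure p (cover_fun \<alpha> \<epsilon> M X)) powr p)
            = (\<epsilon> + 1 / real M powr (\<alpha> / d)) powr p
              - real M * (LBINT t:{\<epsilon> powr p..(\<epsilon> + 1 / real M powr (\<alpha> / d)) powr p}.
                  (t powr (1 / p) - \<epsilon>) powr (d / \<alpha>)))
       \<and> (\<epsilon> = 0 \<longrightarrow>
            (INF X \<in> (configs M :: (nat \<Rightarrow> real ^ 'n) set).
              Lp_norm cube_measure p (cover_fun \<alpha> \<epsilon> M X))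
            \<ge> (d / (d + \<alpha> * p)) powr (1 / p) * (1 / real M powr (\<alpha> / d))
          \<and> (real M powr (1 / d) \<in> \<int> \<longrightarrow>
              (INF X \<in> (configs M :: (nat \<Rightarrow> real ^ 'n) set).
                Lp_norm cube_measure p (cover_fun \<alpha> \<epsilon> M X))
              = (d / (d + \<alpha> * p)) powr (1 / p) * (1 / real M powr (\<alpha> / d))))"
proof -
  let ?cfg = "configs M :: (nat \<Rightarrow> real ^ 'n) set"
  let ?N = "\<lambda>X :: nat \<Rightarrow> real ^ 'n. Lp_norm cube_measure p (cover_fun \<alpha> \<epsilon> M X)"
  define T where "T = (\<epsilon> + 1 / real M powr (\<alpha> / d)) powr p"
  define B where "B = T - real M * (LBINT t:{\<epsilon> powr p..T}. (t powr (1 / p) - \<epsilon>) powr (d / \<alpha>))"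
  \<comment> \<open>With this half-side the M cubes have total volume M (2R)^d = 2^d, that of
    [-1,1]^d, as a tiling requires.\<close>
  define R where "R = 1 / real M powr (1 / d)"
  have pos: "0 < p" "0 < d" "0 \<le> R"
    using assms by (auto simp: R_def)
  have T: "T = profile \<alpha> \<epsilon> p R"
    by (simp add: T_def profile_def R_def powr_divide powr_powr)
  have lower: "B \<le> ?N X powr p" for X
    unfolding B_def T using Lp_norm_cover_fun_ge[of \<alpha> p M \<epsilon> R X] assms pos by simp
  have attained: "\<exists>X\<in>?cfg. ?N X powr p = B" if int: "real M powr (1 / d) \<in> \<int>"
  proof -
    obtain z where z: "real M powr (1 / d) = of_int z"
      using int by (rule Ints_cases)
    define k where "k = nat z"
    \<comment> \<open>Positivity makes \<open>nat z\<close> the d-th root of M itself, so the grid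
      has exactly M = k^d points.\<close>
    have "0 < real_of_int z"
      unfolding z[symmetric] using assms by simp
    then have k: "1 \<le> k" "real M powr (1 / d) = real k"
      using z by (auto simp: k_def)
    have "real M = (real M powr (1 / d)) powr d"
      using pos by (simp add: powr_powr)
    also have "\<dots> = real (k ^ CARD('n))"
      using k d by (simp add: powr_realpow)
    finally have M: "M = k ^ CARD('n)"
      by (simp only: of_nat_eq_iff)
    have R: "R = 1 / real k"
      by (simp add: R_def k)
    show ?thesis
    proof (rule cube_grid[OF k(1), where 'n = 'n])
      fix X :: "nat \<Rightarrow> real ^ 'n"
      assume X: "X \<in> configs (k ^ CARD('n))"
        "\<And>x. x \<in> cube \<Longrightarrow> \<exists>m\<in>{1..k ^ CARD('n)}. infnorm (x - X m) \<le> 1 / real k"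
        "\<And>m x. m \<in> {1..k ^ CARD('n)} \<Longrightarrow> infnorm (x - X m) < 1 / real k \<Longrightarrow> x \<in> cube"
        "\<And>m m' x. \<lbrakk>m \<in> {1..k ^ CARD('n)}; m' \<in> {1..k ^ CARD('n)};
          infnorm (x - X m) < 1 / real k; infnorm (x - X m') < 1 / real k\<rbrakk> \<Longrightarrow> m = m'"
      have "?N X powr p = B"
        unfolding B_def T d
      proof (rule Lp_norm_cover_fun_eq)
        show "\<exists>m\<in>{1..M}. infnorm (x - X m) \<le> R" if "x \<in> cube" for x
          using X(2)[OF that] by (simp only: M R)
        show "x \<in> cube" if "m \<in> {1..M}" "infnorm (x - X m) < R" for m x
          using X(3)[of m x] that by (simp only: M R)
        show "m = m'" if "m \<in> {1..M}" "m' \<in> {1..M}" "infnorm (x - X m) < R" "infnorm (x - X m') < R"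
          for m m' x
          using X(4)[of m m' x] that by (simp only: M R)
      qed (use assms pos in auto)
      then show ?thesis
        using X(1) M by blast
    qed
  qed
  \<comment> \<open>On the reals a lower bound passes to the infimum only for a nonempty
    family.\<close>
  have ne: "?cfg \<noteq> {}"
  proof -
    have "(0 :: real ^ 'n) \<in> cube" by (simp add: mem_cube_iff)
    then show ?thesis by (auto simp: configs_def PiE_eq_empty_iff)
  qed
  have norm_eq: "?N X = (?N X powr p) powr (1 / p)" for X
    using pos by (simp add: powr_powr Lp_norm_nonneg)
  have zero: "B powr (1 / p) = (d / (d + \<alpha> * p)) powr (1 / p) * (1 / real M powr (\<alpha> / d))"
    and B0: "0 \<le> B" if "\<epsilon> = 0"
  proof -
    have B: "B = d / (d + \<alpha> * p) * T"
      using cover_bound_eps_zero[of \<alpha> p M d] assms pos that by (simp add: B_def T_def)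
    show "0 \<le> B"
      unfolding B using assms pos by (simp add: T_def)
    have "T powr (1 / p) = 1 / real M powr (\<alpha> / d)"
      using pos that by (simp add: T_def powr_powr)
    then show "B powr (1 / p) = (d / (d + \<alpha> * p)) powr (1 / p) * (1 / real M powr (\<alpha> / d))"
      unfolding B using assms pos by (subst powr_mult) (auto simp: T_def)
  qed
  \<comment> \<open>Taking p-th roots in \<open>lower\<close> is monotone because B is nonnegative
    when \<epsilon> = 0.\<close>
  have lower': "B powr (1 / p) \<le> ?N X" if "\<epsilon> = 0" for X
    using powr_mono2[OF _ B0[OF that] lower[of X], of "1 / p"] pos norm_eq[of X] by simp
  have inf1: "B \<le> (INF X\<in>?cfg. ?N X powr p)"
    using ne lower by (intro cINF_greatest)
  \<comment> \<open>A lower bound attained by the grid is the infimum.\<close>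
  have inf2: "(INF X\<in>?cfg. ?N X powr p) = B" if "real M powr (1 / d) \<in> \<int>"
    using attained[OF that] lower by (intro cInf_eq_minimum) auto
  have inf3: "B powr (1 / p) \<le> (INF X\<in>?cfg. ?N X)" if "\<epsilon> = 0"
    using ne lower'[OF that] by (intro cINF_greatest)
  have inf4: "(INF X\<in>?cfg. ?N X) = B powr (1 / p)" if "real M powr (1 / d) \<in> \<int>" "\<epsilon> = 0"
  proof (rule cInf_eq_minimum)
    show "B powr (1 / p) \<in> ?N ` ?cfg"
      using attained[OF that(1)] norm_eq by (metis imageI)
  qed (use lower'[OF that(2)] in auto)
  show ?thesis
    using inf1 inf2 inf3 inf4 zero unfolding B_def T_def by simp
qed

end
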